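(* It is impossible to achieve a correct port marking under the TRAN model, even when the agents know $|V|$, $|B|$ and the team size $k$, have infinite memory, and are activated under the fully synchronous scheduler (FSYNCH). That is, there is no deterministic algorithm (possibly depending on $|V|$, $|B|$, $k$, and possibly using unbounded memory) by which a team of $k$ agents activated under FSYNCH achieves a correct port marking on every temporally connected dangerous network $\mathcal G=(G=(V,E),\varrho,\Lambda,B)$ of the TRAN model.
   Context: **Network.** A network is $\mathcal G=(G,\varrho,\Lambda,B)$, where $G=(V,E)$ is a finite simple undirected graph; $\varrho:E\times\mathbb N_0\to\{0,1\}$ says whether edge $e$ is present ($1$) or absent ($0$) at time $t$; $B\subsetneq V$ is the (possibly empty) set of black holes, the nodes of $V\setminus B$ being called safe. No edge joins two black holes. Each node $v$ of degree $\delta(v)$ has, for each incident edge $\{v,w\}\in E$, a port $p_{v,w}$ (there whether or not the edge is currently present); $\Lambda$ consists of bijections $\lambda_v$ from the ports of $v$ to $\{0,\dots,\delta(v)-1\}$, which are fixed, arbitrary and visible only at $v$. Each port has an ingoing and an outgoing sub-port. An edge is recurrent if for every $t$ it is present at some $t'>t$, and transient otherwise. A journey is a sequence $((e_1,t_1),\dots,(e_m,t_m))$ with $(e_1,\dots,e_m)$ a walk in $G$, $t_1<\dots<t_m$ and $\varrho(e_i,t_i)=1$ for all $i$. Networks are always assumed temporally connected: for all $v,w\in V$ and all $t$ there is a journey from $v$ to $w$ starting at a time $\ge t$ containing no black hole except possibly its endpoints $v,w$. The TRAN model consists of all such networks (transient edges allowed). An edge $\{v,w\}$ and its ports are safe if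 $v,w$ are both safe, and dangerous otherwise. **Agents.** A team of $k$ externally indistinguishable agents, initially at the centers of arbitrary safe nodes (several may share a node), all run the same deterministic algorithm. Nodes are anonymous; each node $v$ has a whiteboard (persistent local memory, initially blank, accessed in mutual exclusion). Agents may also have a personal persistent memory. An agent sees only its own node: its position in the node (center or a sub-port), the port labels, the whiteboard, and how many agents are at the center and on each sub-port; it does not see whether incident edges are present. An agent entering a black hole is trapped there forever; otherwise it is free. Time proceeds in rounds $t=0,1,2,\dots$. In each round the activated agents, one after another in some order chosen by the scheduler, read the whiteboard and their memory, compute, possibly rewrite whiteboard and memory, and possibly move to the center or to an outgoing sub-port of the current node; then, simultaneously, each activated agent on the outgoing sub-port of $p_{v,w}$ with $\varrho(\{v,w\},t)=1$ crosses the edge and arrives at the ingoing sub-port of $p_{w,v}$ at $w$. Under FSYNCH all agents are activated in every round. **Correct port marking.** Ports may be marked SAFE or DANGEROUS on the whiteboard of their node. A correct port marking is achieved if at some finite time $t$: at least one agent is free; every port $p_{v,w}$ at a safe node $v$ is marked on the whiteboard of $v$ as DANGEROUS if it is dangerous and as SAFE if it is safe; and these marks never change at times $t'\ge t$. (Marks before time $t$ are unconstrained.) *)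

theory Defs
  imports Main
begin

section \<open>Networks\<close>

record 'v network =
  verts :: "'v set"
  edges :: "'v set set"
  present :: "'v set \<Rightarrow> nat \<Rightarrow> bool"
  label :: "'v \<Rightarrow> 'v \<Rightarrow> nat"  \<comment> \<open>\<open>label N v w\<close> is the label at \<open>v\<close> of the port \<open>p\<^bsub>v,w\<^esub>\<close>\<close>
  holes :: "'v set"

definition nbrs :: "'v network \<Rightarrow> 'v \<Rightarrow> 'v set" where
  "nbrs N v = {w. {v, w} \<in> edges N}"

definition degree :: "'v network \<Rightarrow> 'v \<Rightarrow> nat" where
  "degree N v = card (nbrs N v)"

definition wf_network :: "'v network \<Rightarrow> bool" where
  "wf_network N \<longleftrightarrow>
     finite (verts N) \<and>
     (\<forall>e \<in> edges N. e \<subseteq> verts N \<and> card e = 2) \<and>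
     holes N \<subset> verts N \<and>
     (\<forall>e \<in> edges N. \<not> e \<subseteq> holes N) \<and>
     (\<forall>v \<in> verts N. bij_betw (label N v) (nbrs N v) {..<degree N v})"

text \<open>A journey is given by its successive nodes \<open>vs\<close>, which determine its edges since the
  graph is simple, and by the times \<open>ts\<close> at which these edges are crossed.\<close>

definition journey :: "'v network \<Rightarrow> 'v list \<Rightarrow> nat list \<Rightarrow> bool" where
  "journey N vs ts \<longleftrightarrow>
     length vs = Suc (length ts) \<and> set vs \<subseteq> verts N \<and> sorted_wrt (<) ts \<and>
     (\<forall>i < length ts. {vs ! i, vs ! Suc i} \<in> edges N \<and> present N {vs ! i, vs ! Suc i} (ts ! i))"

definition temporally_connected :: "'v network \<Rightarrow> bool" where
  "temporally_connected N \<longleftrightarrow>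
     (\<forall>v \<in> verts N. \<forall>w \<in> verts N. \<forall>t. \<exists>vs ts.
        journey N vs ts \<and> hd vs = v \<and> last vs = w \<and> (\<forall>s \<in> set ts. t \<le> s) \<and>
        set vs \<inter> holes N \<subseteq> {v, w})"

definition TRAN :: "'v network set" where
  "TRAN = {N. wf_network N \<and> temporally_connected N}"

definition safe_node :: "'v network \<Rightarrow> 'v \<Rightarrow> bool" where
  "safe_node N v \<longleftrightarrow> v \<in> verts N \<and> v \<notin> holes N"

text \<open>A port is safe or dangerous according to its edge.\<close>

definition safe_edge :: "'v network \<Rightarrow> 'v set \<Rightarrow> bool" where
  "safe_edge N e \<longleftrightarrow> e \<in> edges N \<and> (\<forall>v \<in> e. safe_node N v)"


section \<open>Agents\<close>

datatype place = Center | Ingoing nat | Outgoing nat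

datatype move = Stay | To_Center | To_Outgoing nat

datatype mark = SAFE | DANGEROUS

text \<open>A whiteboard carries a (possibly missing) mark for every port label and further contents
  of arbitrary type \<open>'w\<close>.\<close>

record 'w whiteboard =
  marks :: "nat \<Rightarrow> mark option"
  content :: 'w

text \<open>All that an agent with memory of type \<open>'m\<close> can see. The port labels visible at a node are
  exactly the numbers below the degree.\<close>

record ('w, 'm) view =
  own_place :: place
  own_memory :: 'm
  node_degree :: nat
  node_board :: "'w whiteboard"
  agents_at :: "place \<Rightarrow> nat"

text \<open>The types \<open>'w\<close> and \<open>'m\<close> and the function \<open>compute\<close> are arbitrary, so neither the amount
  of memory nor computability is restricted.\<close>

record ('w, 'm) algorithm =
  blank_content :: 'w
  initial_memory :: 'm
  compute :: "('w, 'm) view \<Rightarrow> 'w whiteboard \<times> 'm \<times> move"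

text \<open>The \<open>k\<close> agents are the numbers below \<open>k\<close>; these are names for the environment only, as they
  do not occur in the views.\<close>

record ('v, 'w, 'm) config =
  node_of :: "nat \<Rightarrow> 'v"
  place_of :: "nat \<Rightarrow> place"
  memory_of :: "nat \<Rightarrow> 'm"
  board_of :: "'v \<Rightarrow> 'w whiteboard"

definition initial_config ::
  "('w, 'm) algorithm \<Rightarrow> (nat \<Rightarrow> 'v) \<Rightarrow> ('v, 'w, 'm) config" where
  "initial_config A start =
     \<lparr>node_of = start, place_of = (\<lambda>_. Center), memory_of = (\<lambda>_. initial_memory A),
      board_of = (\<lambda>_. \<lparr>marks = (\<lambda>_. None), content = blank_content A\<rparr>)\<rparr>"

definition view_of ::
  "'v network \<Rightarrow> nat \<Rightarrow> ('v, 'w, 'm) config \<Rightarrow> nat \<Rightarrow> ('w, 'm) view" where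
  "view_of N k c i =
     \<lparr>own_place = place_of c i, own_memory = memory_of c i,
      node_degree = degree N (node_of c i), node_board = board_of c (node_of c i),
      agents_at = (\<lambda>x. card {j. j < k \<and> node_of c j = node_of c i \<and> place_of c j = x})\<rparr>"

text \<open>Moving to a port that does not exist has no effect.\<close>

fun apply_move :: "nat \<Rightarrow> move \<Rightarrow> place \<Rightarrow> place" where
  "apply_move d Stay x = x"
| "apply_move d To_Center x = Center"
| "apply_move d (To_Outgoing p) x = (if p < d then Outgoing p else x)"

text \<open>An agent in a black hole is trapped: it never acts again.\<close>

definition activate ::
  "'v network \<Rightarrow> ('w, 'm) algorithm \<Rightarrow> nat \<Rightarrow> nat \<Rightarrow> ('v, 'w, 'm) config \<Rightarrow> ('v, 'w, 'm) config" where
  "activate N A k i c =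
     (if node_of c i \<in> holes N then c
      else let v = node_of c i; (b, m, mv) = compute A (view_of N k c i)
           in c\<lparr>place_of := (place_of c)(i := apply_move (degree N v) mv (place_of c i)),
                memory_of := (memory_of c)(i := m),
                board_of := (board_of c)(v := b)\<rparr>)"

definition cross :: "'v network \<Rightarrow> nat \<Rightarrow> 'v \<times> place \<Rightarrow> 'v \<times> place" where
  "cross N t vx =
     (case vx of
        (v, Outgoing p) \<Rightarrow>
          let w = (THE w. w \<in> nbrs N v \<and> label N v w = p)
          in if present N {v, w} t then (w, Ingoing (label N w v)) else vx
      | _ \<Rightarrow> vx)"

text \<open>Under FSYNCH the scheduler only chooses, for every round, the order in which the agents act.\<close>

definition fsynch_schedule :: "nat \<Rightarrow> (nat \<Rightarrow> nat list) \<Rightarrow> bool" where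
  "fsynch_schedule k order \<longleftrightarrow> (\<forall>t. distinct (order t) \<and> set (order t) = {..<k})"

definition do_round ::
  "'v network \<Rightarrow> ('w, 'm) algorithm \<Rightarrow> nat \<Rightarrow> nat list \<Rightarrow> nat
     \<Rightarrow> ('v, 'w, 'm) config \<Rightarrow> ('v, 'w, 'm) config" where
  "do_round N A k is t c =
     (let c' = fold (activate N A k) is c
      in c'\<lparr>node_of := (\<lambda>i. fst (cross N t (node_of c' i, place_of c' i))),
            place_of := (\<lambda>i. snd (cross N t (node_of c' i, place_of c' i)))\<rparr>)"

text \<open>The configuration at time \<open>t\<close>, i.e. at the beginning of round \<open>t\<close>.\<close>

primrec run ::
  "'v network \<Rightarrow> ('w, 'm) algorithm \<Rightarrow> nat \<Rightarrow> (nat \<Rightarrow> 'v) \<Rightarrow> (nat \<Rightarrow> nat list) \<Rightarrow> nat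
     \<Rightarrow> ('v, 'w, 'm) config" where
  "run N A k start order 0 = initial_config A start"
| "run N A k start order (Suc t) = do_round N A k (order t) t (run N A k start order t)"


section \<open>Correct port marking\<close>

definition port_mark :: "'v network \<Rightarrow> ('v, 'w, 'm) config \<Rightarrow> 'v \<Rightarrow> 'v \<Rightarrow> mark option" where
  "port_mark N c v w = marks (board_of c v) (label N v w)"

definition achieves_correct_port_marking ::
  "'v network \<Rightarrow> ('w, 'm) algorithm \<Rightarrow> nat \<Rightarrow> (nat \<Rightarrow> 'v) \<Rightarrow> (nat \<Rightarrow> nat list) \<Rightarrow> bool" where
  "achieves_correct_port_marking N A k start order \<longleftrightarrow>
     (\<exists>t. (\<exists>i < k. node_of (run N A k start order t) i \<notin> holes N) \<and>
          (\<forall>v w. safe_node N v \<and> w \<in> nbrs N v \<longrightarrow>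
             port_mark N (run N A k start order t) v w =
               Some (if safe_edge N {v, w} then SAFE else DANGEROUS) \<and>
             (\<forall>t' \<ge> t. port_mark N (run N A k start order t') v w =
                        port_mark N (run N A k start order t) v w)))"

text \<open>Success is required for all choices of the adversary: the initial safe nodes of the agents
  and the activation orders.\<close>

definition solves_port_marking_fsynch ::
  "'v network \<Rightarrow> ('w, 'm) algorithm \<Rightarrow> nat \<Rightarrow> bool" where
  "solves_port_marking_fsynch N A k \<longleftrightarrow>
     (\<forall>start order. (\<forall>i < k. safe_node N (start i)) \<and> fsynch_schedule k order \<longrightarrow>
        achieves_correct_port_marking N A k start order)"

end

(* Agents learn about an edge only by crossing it. In a star with safe center 4 and leaves 0, ..., 3,
   whose edges are always present, the leaves are joined in addition by a perfect matching whose
   edges are never present. Leaf 0 is the black hole. The matchings 0-3, 1-2 and 0-1, 2-3 give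
   networks with the same runs, but the matching port of leaf 1 is safe in the first and dangerous
   in the second, so no mark of it is correct in both. *)
theory Submission
  imports Defs
begin

text \<open>Views depend on the network only through the degrees, and a round uses it beyond that
  only through \<open>holes\<close> and \<open>cross\<close>. Edges, their presence and the labels
  of ports thus affect a run only through these three functions.\<close>

lemma run_cong:
  assumes holes: "holes M = holes N" and degree: "degree M = degree N"
    and cross: "cross M = cross N"
  shows "run M A k start order t = run N A k start order t"
proof -
  have "view_of M k c i = view_of N k c i" for c :: "('a, 'b, 'c) config" and i
    by (simp add: view_of_def degree)
  hence "activate M A k = activate N A k"
    by (intro ext) (simp add: activate_def holes degree)
  thus ?thesis
    by (induction t) (simp_all add: do_round_def cross)
qed

text \<open>Presence and labels are chosen independent of \<open>f\<close>: a leaf has label 0 for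
  its port to the center 4 and label 1 for its port to its partner, whoever that is.\<close>

definition matched_star :: "(nat \<Rightarrow> nat) \<Rightarrow> nat network" where
  "matched_star f =
     \<lparr>verts = {..4}, edges = (\<lambda>i. {4, i}) ` {..<4} \<union> (\<lambda>i. {i, f i}) ` {..<4},
      present = (\<lambda>e t. 4 \<in> e),
      label = (\<lambda>v w. if v = 4 then w else if w = 4 then 0 else 1), holes = {0}\<rparr>"

lemma matched_star_sel [simp]:
  "verts (matched_star f) = {..4}" "holes (matched_star f) = {0}"
  "present (matched_star f) e t \<longleftrightarrow> 4 \<in> e"
  "label (matched_star f) v w = (if v = 4 then w else if w = 4 then 0 else 1)"
  "edges (matched_star f) = (\<lambda>i. {4, i}) ` {..<4} \<union> (\<lambda>i. {i, f i}) ` {..<4}"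
  by (simp_all add: matched_star_def)

text \<open>Fixed-point-free involutions of the leaves are the perfect matchings between
  them.\<close>

definition matching :: "(nat \<Rightarrow> nat) \<Rightarrow> bool" where
  "matching f \<longleftrightarrow> (\<forall>i<4. f i < 4 \<and> f i \<noteq> i \<and> f (f i) = i)"

lemma nbrs_matched_star:
  assumes "matching f"
  shows "nbrs (matched_star f) v = (if v = 4 then {..<4} else if v < 4 then {4, f v} else {})"
  using assms unfolding nbrs_def matching_def
  by (auto simp: doubleton_eq_iff image_iff)

lemma degree_matched_star:
  assumes "matching f"
  shows "degree (matched_star f) v = (if v = 4 then 4 else if v < 4 then 2 else 0)"
proof -
  have "v < 4 \<Longrightarrow> f v \<noteq> 4"
    using assms by (auto simp: matching_def)
  thus ?thesis
    using assms by (auto simp: degree_def nbrs_matched_star card_insert_if)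
qed

text \<open>The two networks differ only in where port 1 of a leaf leads. That edge is never
  present, so an agent waiting there stays in both networks.\<close>

lemma cross_matched_star:
  assumes f: "matching f" and g: "matching g"
  shows "cross (matched_star f) = cross (matched_star g)"
proof (intro ext)
  fix t and vx :: "nat \<times> place"
  obtain v x where vx: "vx = (v, x)" by (cases vx)
  show "cross (matched_star f) t vx = cross (matched_star g) t vx"
  proof (cases "\<exists>p. x = Outgoing p \<and> v < 4 \<and> p = 1")
    case True
    have uncrossed: "cross (matched_star h) t vx = vx" if h: "matching h" for h
    proof -
      from h True have "h v < 4" by (auto simp: matching_def)
      hence "(THE w. w \<in> nbrs (matched_star h) v \<and> label (matched_star h) v w = 1) = h v"
        using h True by (intro the_equality) (auto simp: nbrs_matched_star)
      thus ?thesis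
        using True \<open>h v < 4\<close> by (auto simp: vx cross_def Let_def)
    qed
    show ?thesis by (simp only: uncrossed[OF f] uncrossed[OF g])
  next
    case False
    \<comment> \<open>Equality of the predicates makes the \<open>THE\<close> terms agree even for a
      label \<open>p\<close> without a port, where their value is unspecified.\<close>
    have "(\<lambda>w. w \<in> nbrs (matched_star f) v \<and> label (matched_star f) v w = p) =
          (\<lambda>w. w \<in> nbrs (matched_star g) v \<and> label (matched_star g) v w = p)"
      if "x = Outgoing p" for p
      using that False f g
      by (intro ext) (auto simp: nbrs_matched_star matching_def)
    moreover have "present (matched_star f) = present (matched_star g)"
      "label (matched_star f) = label (matched_star g)"
      by (intro ext; simp)+
    ultimately show ?thesis
      by (cases x) (simp_all add: vx cross_def Let_def del: matched_star_sel)
  qed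
qed

lemma wf_matched_star:
  assumes f: "matching f"
  shows "wf_network (matched_star f)"
proof -
  have "bij_betw (label (matched_star f) v) (nbrs (matched_star f) v)
          {..<degree (matched_star f) v}" if "v \<le> 4" for v
  proof (cases "v = 4")
    case True
    thus ?thesis
      using f by (simp add: nbrs_matched_star degree_matched_star bij_betw_def inj_on_def)
  next
    case False
    hence "v < 4" "f v < 4" using that f by (auto simp: matching_def)
    thus ?thesis
      using f by (auto simp: nbrs_matched_star degree_matched_star bij_betw_def inj_on_def)
  qed
  \<comment> \<open>With 0 as the only black hole, a matching edge between black holes would be a
    loop, which \<open>f i \<noteq> i\<close> excludes.\<close>
  moreover have "card {i, f i} = 2" "f i < 4" "\<not> {i, f i} \<subseteq> {0}" if "i < 4" for i
    using f that by (auto simp: matching_def card_insert_if)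
  ultimately show ?thesis
    by (fastforce simp: wf_network_def card_insert_if)
qed

text \<open>The star edges are always present and the center is safe, so at most two hops via the
  center suffice, and the black hole occurs only as an endpoint.\<close>

lemma temporally_connected_matched_star: "temporally_connected (matched_star f)"
  unfolding temporally_connected_def
proof (intro ballI allI)
  fix v w t
  assume vw: "v \<in> verts (matched_star f)" "w \<in> verts (matched_star f)"
  have star: "{4, i} \<in> edges (matched_star f)" "{i, 4} \<in> edges (matched_star f)"
    if "i \<le> 4" "i \<noteq> 4" for i
    using that by (auto simp: insert_commute)
  have le: "v \<le> 4" "w \<le> 4" using vw by simp_all
  consider "v = w" | "v = 4" "w \<noteq> 4" | "v \<noteq> 4" "w = 4" | "v \<noteq> 4" "w \<noteq> 4"
    by blast
  thus "\<exists>vs ts. journey (matched_star f) vs ts \<and> hd vs = v \<and> last vs = w \<and>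
          (\<forall>s \<in> set ts. t \<le> s) \<and> set vs \<inter> holes (matched_star f) \<subseteq> {v, w}"
  proof cases
    case 1
    thus ?thesis
      using le by (intro exI[of _ "[v]"] exI[of _ "[]"]) (auto simp: journey_def)
  next
    case 2
    thus ?thesis
      using le by (intro exI[of _ "[v, w]"] exI[of _ "[t]"]) (auto simp: journey_def star)
  next
    case 3
    thus ?thesis
      using le by (intro exI[of _ "[v, w]"] exI[of _ "[t]"]) (auto simp: journey_def star)
  next
    case 4
    \<comment> \<open>The second hop takes place at \<open>Suc t\<close> because the times of a
      journey increase strictly.\<close>
    thus ?thesis
      using le by (intro exI[of _ "[v, 4, w]"] exI[of _ "[t, Suc t]"])
        (auto simp: journey_def star less_Suc_eq nth_Cons')
  qed
qed

theorem theorem4: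
  fixes k :: nat
  shows "\<not> (\<exists>A :: nat \<Rightarrow> nat \<Rightarrow> nat \<Rightarrow> ('w, 'm) algorithm.
            \<forall>N :: nat network. N \<in> TRAN \<and> holes N \<noteq> {} \<longrightarrow>
              solves_port_marking_fsynch N (A (card (verts N)) (card (holes N)) k) k)"
proof
  assume "\<exists>A :: nat \<Rightarrow> nat \<Rightarrow> nat \<Rightarrow> ('w, 'm) algorithm.
            \<forall>N :: nat network. N \<in> TRAN \<and> holes N \<noteq> {} \<longrightarrow>
              solves_port_marking_fsynch N (A (card (verts N)) (card (holes N)) k) k"
  then obtain A :: "nat \<Rightarrow> nat \<Rightarrow> nat \<Rightarrow> ('w, 'm) algorithm" where
    A: "\<And>N :: nat network. N \<in> TRAN \<Longrightarrow> holes N \<noteq> {} \<Longrightarrow>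
          solves_port_marking_fsynch N (A (card (verts N)) (card (holes N)) k) k"
    by blast
  define f g :: "nat \<Rightarrow> nat" where
    "f = (\<lambda>i. 3 - i)" and "g = (\<lambda>i. if i < 2 then 1 - i else 5 - i)"
  have f: "matching f" and g: "matching g"
    by (auto simp: matching_def f_def g_def, presburger+)
  \<comment> \<open>Both networks have five nodes and one black hole, so the same algorithm
    \<open>A 5 1 k\<close> runs on them. All agents start at the safe center.\<close>
  define c where "c N = run N (A 5 1 k) k (\<lambda>_. 4) (\<lambda>_. [0..<k])" for N :: "nat network"
  have same: "c (matched_star f) = c (matched_star g)"
    unfolding c_def using f g
    by (intro ext run_cong cross_matched_star)
      (simp_all add: fun_eq_iff degree_matched_star)
  \<comment> \<open>Label 1 at leaf 1 belongs to the port to its partner \<open>h 1\<close>, which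
    is dangerous exactly if \<open>h 1\<close> is the black hole 0.\<close>
  have final: "\<exists>t. \<forall>t' \<ge> t. marks (board_of (c (matched_star h) t') 1) 1 =
                 Some (if h 1 = 0 then DANGEROUS else SAFE)" if h: "matching h" for h
  proof -
    let ?N = "matched_star h"
    have "?N \<in> TRAN"
      using h by (simp add: TRAN_def wf_matched_star temporally_connected_matched_star)
    from A[OF this] have "solves_port_marking_fsynch ?N (A 5 1 k) k"
      by simp
    hence "achieves_correct_port_marking ?N (A 5 1 k) k (\<lambda>_. 4) (\<lambda>_. [0..<k])"
      unfolding solves_port_marking_fsynch_def
      by (elim allE impE) (simp_all add: fsynch_schedule_def safe_node_def atLeast0LessThan)
    then obtain t where t: "\<And>v w. safe_node ?N v \<Longrightarrow> w \<in> nbrs ?N v \<Longrightarrow>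
        port_mark ?N (c ?N t) v w = Some (if safe_edge ?N {v, w} then SAFE else DANGEROUS) \<and>
        (\<forall>t' \<ge> t. port_mark ?N (c ?N t') v w = port_mark ?N (c ?N t) v w)"
      unfolding achieves_correct_port_marking_def c_def by blast
    have h1: "h 1 < 4" using h by (simp add: matching_def)
    have nbr: "h 1 \<in> nbrs ?N 1" using h by (simp add: nbrs_matched_star)
    hence "safe_edge ?N {1, h 1} \<longleftrightarrow> h 1 \<noteq> 0"
      using h1 by (auto simp: safe_edge_def safe_node_def nbrs_def)
    moreover have "port_mark ?N d 1 (h 1) = marks (board_of d 1) 1"
      for d :: "(nat, 'w, 'm) config"
      using h1 by (simp add: port_mark_def)
    moreover have "safe_node ?N 1" by (simp add: safe_node_def)
    ultimately show ?thesis
      using t[OF _ nbr] by (intro exI[of _ t]) auto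
  qed
  obtain t u where
    "\<forall>t' \<ge> t. marks (board_of (c (matched_star f) t') 1) 1 = Some SAFE"
    "\<forall>t' \<ge> u. marks (board_of (c (matched_star g) t') 1) 1 = Some DANGEROUS"
    using final[OF f] final[OF g] by (auto simp: f_def g_def)
  \<comment> \<open>At time \<open>max t u\<close> both marks are final, yet they are read from the
    same run.\<close>
  hence "Some SAFE = Some DANGEROUS"
    unfolding same by (metis max.cobounded1 max.cobounded2)
  thus False by simp
qed

end
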